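(* Let $n=p_1\cdots p_t$ be a square-free positive integer, where $p_1,\dots,p_t$ are pairwise distinct primes. Let $m_1$ be an integer with $\gcd(m_1,n)=1$. Then $$\left|\{m_2 : 0\le m_2<n,\ \gcd(m_2,n)=1,\ 12s(m_1/n)-12s(m_2/n)\in\mathbb{Z}\}\right| = 2^s,$$ where $s=|\{j : 1\le j\le t,\ m_1\not\equiv \pm 1 \pmod{p_j}\}|$.
   Context: For a positive integer $n$ and an integer $m$ with $\gcd(m,n)=1$, the Dedekind sum is $s(m/n)=\sum_{k=1}^{n} ((k/n))((mk/n))$, where $((x))=x-\lfloor x\rfloor-1/2$ if $x\notin\mathbb{Z}$ and $((x))=0$ if $x\in\mathbb{Z}$ (the sawtooth function). *)

theory Defs
  imports Complex_Main "HOL-Number_Theory.Number_Theory"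
begin

definition sawtooth :: "real \<Rightarrow> real" where
  "sawtooth x = (if x \<in> \<int> then 0 else x - of_int \<lfloor>x\<rfloor> - 1/2)"

(* The classical s(m/n); meant for n > 0 and gcd(m, n) = 1. *)
definition dedekind_sum :: "int \<Rightarrow> nat \<Rightarrow> real" where
  "dedekind_sum m n =
     (\<Sum>k = 1..n. sawtooth (real k / real n) * sawtooth (of_int m * real k / real n))"

end

theory Submission
  imports Defs
begin

text \<open>
  Write \<open>m k = r\<^sub>k + n f\<^sub>k\<close> with \<open>0 \<le> r\<^sub>k < n\<close>. Since \<open>k \<mapsto> r\<^sub>k\<close> permutes the nonzero residues,
  expanding the Dedekind sum expresses \<open>12 n s(m/n)\<close> through \<open>\<Sum> k f\<^sub>k\<close>, and comparing
  \<open>\<Sum> r\<^sub>k\<^sup>2\<close> with \<open>\<Sum> k\<^sup>2\<close> determines \<open>m \<Sum> k f\<^sub>k\<close> modulo \<open>n\<close>. The outcome is that \<open>12 n s(m/n)\<close> is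
  an integer congruent to \<open>m + m\<^sup>-\<^sup>1\<close> modulo \<open>n\<close>. Hence \<open>12 s(m\<^sub>1/n) - 12 s(m\<^sub>2/n)\<close> is an integer iff
  \<open>n\<close> divides \<open>(m\<^sub>1 - m\<^sub>2) (m\<^sub>1 m\<^sub>2 - 1)\<close>. Modulo a prime \<open>p\<close> the solutions are \<open>m\<^sub>1\<close> and \<open>m\<^sub>1\<^sup>-\<^sup>1\<close>,
  which coincide iff \<open>m\<^sub>1 \<equiv> \<plusminus>1\<close>, and the Chinese remainder theorem multiplies the local counts.
\<close>

section \<open>Multiplication by a unit permutes the nonzero residues\<close>

lemma bij_betw_mult_mod:
  fixes m :: int
  assumes "coprime m (int n)"
  shows "bij_betw (\<lambda>k. m * int k mod int n) {1..<n} {1..<int n}"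
proof -
  have inj: "inj_on (\<lambda>k. m * int k mod int n) {1..<n}"
  proof (rule inj_onI)
    fix j k assume jk: "j \<in> {1..<n}" "k \<in> {1..<n}" "m * int j mod int n = m * int k mod int n"
    then have "[m * int j = m * int k] (mod int n)"
      by (simp add: cong_def)
    then have "[int j = int k] (mod int n)"
      using assms cong_mult_lcancel by blast
    with jk show "j = k"
      by (simp add: cong_def)
  qed
  have "(\<lambda>k. m * int k mod int n) ` {1..<n} \<subseteq> {1..<int n}"
  proof clarify
    fix k assume k: "k \<in> {1..<n}"
    have "\<not> int n dvd m * int k"
    proof
      assume "int n dvd m * int k"
      then have "int n dvd int k"
        using assms by (simp add: coprime_commute coprime_dvd_mult_right_iff)
      then show False using k by (auto dest: zdvd_imp_le)
    qed
    then have "m * int k mod int n \<noteq> 0" by (simp add: dvd_eq_mod_eq_0)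
    moreover have "0 \<le> m * int k mod int n" "m * int k mod int n < int n"
      using k by auto
    ultimately show "m * int k mod int n \<in> {1..<int n}" by auto
  qed
  \<comment> \<open>An injection into a finite set of the same size is onto.\<close>
  moreover have "card ((\<lambda>k. m * int k mod int n) ` {1..<n}) = card {1..<int n}"
    using inj by (simp add: card_image nat_diff_distrib)
  ultimately have "(\<lambda>k. m * int k mod int n) ` {1..<n} = {1..<int n}"
    by (intro card_subset_eq) auto
  with inj show ?thesis by (simp add: bij_betw_def)
qed

lemma sum_mult_mod:
  fixes m :: int and g :: "int \<Rightarrow> 'a::comm_monoid_add"
  assumes "coprime m (int n)"
  shows "(\<Sum>k = 1..<n. g (m * int k mod int n)) = (\<Sum>k = 1..<n. g (int k))"
proof -
  have "(\<Sum>k = 1..<n. g (m * int k mod int n)) = sum g {1..<int n}"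
    by (rule sum.reindex_bij_betw[OF bij_betw_mult_mod[OF assms]])
  also have "\<dots> = (\<Sum>k = 1..<n. g (int k))"
    \<comment> \<open>Multiplier 1 merely transfers the integer index set back to the natural
      numbers.\<close>
    using sum.reindex_bij_betw[OF bij_betw_mult_mod[of 1 n], of g] by simp
  finally show ?thesis .
qed

section \<open>Dedekind sums modulo \<open>n\<close>\<close>

lemma sawtooth_int_divide:
  assumes "n > 0" "\<not> int n dvd a"
  shows "sawtooth (of_int a / real n) = of_int (a mod int n) / real n - 1 / 2"
proof -
  have "of_int a / real n \<notin> \<int>"
  proof
    assume "of_int a / real n \<in> \<int>"
    then obtain b where "of_int a / real n = of_int b" by (elim Ints_cases)
    with \<open>n > 0\<close> have "real_of_int a = of_int (b * int n)" by (simp add: field_simps)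
    then have "a = b * int n" by linarith
    with assms(2) show False by simp
  qed
  moreover have "\<lfloor>real_of_int a / real n\<rfloor> = a div int n"
    using floor_divide_of_int_eq[of a "int n"] by simp
  moreover have "real_of_int a = of_int (a mod int n) + real n * of_int (a div int n)"
    by (metis mod_mult_div_eq of_int_add of_int_mult of_int_of_nat_eq)
  then have "real_of_int a / real n - of_int (a div int n) = of_int (a mod int n) / real n"
    using \<open>n > 0\<close> by (simp add: field_simps)
  ultimately show ?thesis by (simp add: sawtooth_def)
qed

lemma sum_lessThan_from_1: "2 * (\<Sum>k = 1..<n. int k) = int n * (int n - 1)"
proof (induction n)
  case (Suc n)
  then show ?case by (cases "n = 0") (auto simp: algebra_simps)
qed simp

lemma sum_squares_lessThan_from_1:
  "6 * (\<Sum>k = 1..<n. (int k)\<^sup>2) = int n * (int n - 1) * (2 * int n - 1)"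
proof (induction n)
  case (Suc n)
  then show ?case by (cases "n = 0") (auto simp: algebra_simps power2_eq_square)
qed simp

lemma dedekind_sum_eq:
  assumes "n > 0" "coprime m (int n)"
  shows "real n ^ 2 * (12 * dedekind_sum m n) =
    of_int (12 * (\<Sum>k = 1..<n. int k * (m * int k mod int n)) - 3 * int n ^ 2 * (int n - 1))"
proof -
  define r where "r k = m * int k mod int n" for k
  have saw: "sawtooth (real k / real n) * sawtooth (of_int m * real k / real n)
      = (real k / real n - 1 / 2) * (of_int (r k) / real n - 1 / 2)" if k: "k \<in> {1..<n}" for k
  proof -
    have ndvd: "\<not> int n dvd int k" using k by (auto dest: zdvd_imp_le)
    then have "\<not> int n dvd m * int k"
      using assms(2) by (simp add: coprime_commute coprime_dvd_mult_right_iff)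
    with sawtooth_int_divide[OF assms(1) ndvd] sawtooth_int_divide[OF assms(1), of "m * int k"] k
    show ?thesis by (simp add: r_def)
  qed
  \<comment> \<open>The last summand \<open>k = n\<close> vanishes, leaving only nonzero residues,
    where the sawtooth is given by a remainder.\<close>
  have "sawtooth (real n / real n) = 0"
    using assms(1) by (simp add: sawtooth_def)
  moreover have "{1..n} = insert n {1..<n}" using assms(1) by auto
  ultimately have "dedekind_sum m n =
      (\<Sum>k = 1..<n. sawtooth (real k / real n) * sawtooth (of_int m * real k / real n))"
    by (simp add: dedekind_sum_def)
  also have "\<dots> = (\<Sum>k = 1..<n. (real k / real n - 1 / 2) * (of_int (r k) / real n - 1 / 2))"
    by (rule sum.cong[OF refl saw])
  finally have "real n ^ 2 * (12 * dedekind_sum m n) = (\<Sum>k = 1..<n.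
      real n ^ 2 * (12 * ((real k / real n - 1 / 2) * (of_int (r k) / real n - 1 / 2))))"
    by (simp add: sum_distrib_left)
  \<comment> \<open>Each summand equals \<open>12 * (k - n/2) * (r k - n/2)\<close>, whose expansion
    has integer coefficients.\<close>
  also have "\<dots> = (\<Sum>k = 1..<n. of_int (12 * (int k * r k) - 6 * int n * int k - 6 * int n * r k
      + 3 * int n ^ 2))"
    using assms(1) by (intro sum.cong refl) (simp add: field_simps power2_eq_square)
  also have "\<dots> = of_int (12 * (\<Sum>k = 1..<n. int k * r k) - 6 * int n * (\<Sum>k = 1..<n. int k)
      - 6 * int n * (\<Sum>k = 1..<n. r k) + 3 * int n ^ 2 * (int n - 1))"
    using assms(1)
    by (simp add: sum.distrib sum_subtractf sum_distrib_left of_nat_diff algebra_simps)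
  also have "(\<Sum>k = 1..<n. r k) = (\<Sum>k = 1..<n. int k)"
    unfolding r_def by (rule sum_mult_mod[OF assms(2)])
  also have "12 * (\<Sum>k = 1..<n. int k * r k) - 6 * int n * (\<Sum>k = 1..<n. int k)
      - 6 * int n * (\<Sum>k = 1..<n. int k) + 3 * int n ^ 2 * (int n - 1)
    = 12 * (\<Sum>k = 1..<n. int k * r k) - 6 * int n * (2 * (\<Sum>k = 1..<n. int k))
      + 3 * int n ^ 2 * (int n - 1)"
    by (simp add: algebra_simps)
  also have "\<dots> = 12 * (\<Sum>k = 1..<n. int k * r k) - 3 * int n ^ 2 * (int n - 1)"
    unfolding sum_lessThan_from_1 by (simp add: algebra_simps power2_eq_square)
  finally show ?thesis by (simp add: r_def)
qed

text \<open>This is \<open>d = m + 1/m\<close> modulo \<open>n\<close>, multiplied by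
  \<open>m\<close> so that no inverse has to be named.\<close>

lemma dedekind_sum_cong:
  assumes "n > 0" "coprime m (int n)"
  obtains d where "of_int d = 12 * real n * dedekind_sum m n" "[m * d = m\<^sup>2 + 1] (mod int n)"
proof -
  define f where "f k = m * int k div int n" for k
  define N F G Q where "N = int n" and "F = (\<Sum>k = 1..<n. int k * f k)"
    and "G = (\<Sum>k = 1..<n. (f k)\<^sup>2)" and "Q = (\<Sum>k = 1..<n. (int k)\<^sup>2)"
  have N: "N > 0" using assms(1) by (simp add: N_def)
  have r: "m * int k mod int n = m * int k - N * f k" for k
    by (simp add: f_def N_def minus_mult_div_eq_mod)
  have Q6: "6 * Q = N * (N - 1) * (2 * N - 1)"
    unfolding Q_def N_def by (rule sum_squares_lessThan_from_1)
  have S: "(\<Sum>k = 1..<n. int k * (m * int k mod int n)) = m * Q - N * F"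
    by (simp add: r Q_def F_def sum_subtractf sum_distrib_left algebra_simps power2_eq_square)
  \<comment> \<open>Evaluating the sum of squared remainders in two ways, by permutation and by
    expansion, gives a relation for \<open>F\<close>.\<close>
  have "(\<Sum>k = 1..<n. (m * int k mod int n)\<^sup>2) = Q"
    unfolding Q_def by (rule sum_mult_mod[OF assms(2), of "\<lambda>x. x\<^sup>2"])
  moreover have "(\<Sum>k = 1..<n. (m * int k mod int n)\<^sup>2) = m\<^sup>2 * Q - 2 * m * N * F + N\<^sup>2 * G"
    by (simp add: r Q_def F_def G_def sum_subtractf sum.distrib sum_distrib_left algebra_simps
        power2_eq_square)
  ultimately have "6 * (m\<^sup>2 * Q - 2 * m * N * F + N\<^sup>2 * G) = 6 * Q" by simp
  then have "N * (12 * m * F) = (m\<^sup>2 - 1) * (6 * Q) + N * (6 * N * G)"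
    by (simp add: algebra_simps power2_eq_square)
  \<comment> \<open>Since \<open>6 * Q\<close> is a multiple of \<open>N\<close>, one factor
    \<open>N\<close> cancels and \<open>12 * m * F\<close> is still known modulo
    \<open>N\<close>.\<close>
  then have "N * (12 * m * F) = N * ((m\<^sup>2 - 1) * (N - 1) * (2 * N - 1) + 6 * N * G)"
    unfolding Q6 by (simp add: algebra_simps)
  then have mF: "12 * m * F = (m\<^sup>2 - 1) * (N - 1) * (2 * N - 1) + 6 * N * G"
    using N by simp
  \<comment> \<open>The integer from \<open>dedekind_sum_eq\<close>, divided by
    \<open>N\<close>.\<close>
  define d where "d = 2 * m * (N - 1) * (2 * N - 1) - 12 * F - 3 * N * (N - 1)"
  have "12 * (m * Q - N * F) - 3 * N\<^sup>2 * (N - 1) = 2 * m * (6 * Q) - 12 * N * F - 3 * N\<^sup>2 * (N - 1)"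
    by (simp add: algebra_simps)
  also have "\<dots> = N * d"
    unfolding Q6 d_def by (simp add: algebra_simps power2_eq_square)
  finally have "real n ^ 2 * (12 * dedekind_sum m n) = of_int (N * d)"
    using dedekind_sum_eq[OF assms] unfolding S N_def by simp
  then have "of_int d = 12 * real n * dedekind_sum m n"
    using assms(1) by (simp add: N_def power2_eq_square)
  moreover have "m * d - (m\<^sup>2 + 1) =
      2 * m\<^sup>2 * (N - 1) * (2 * N - 1) - 12 * m * F - 3 * m * N * (N - 1) - (m\<^sup>2 + 1)"
    by (simp add: d_def algebra_simps power2_eq_square)
  \<comment> \<open>Modulo \<open>N\<close> the terms reduce to
    \<open>2 * m^2 - (m^2 - 1) - (m^2 + 1) = 0\<close>; the right side displays the quotient by
    \<open>N\<close>.\<close>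
  then have "m * d - (m\<^sup>2 + 1) =
      N * ((m\<^sup>2 + 1) * (2 * N - 3) - 6 * G - 3 * m * (N - 1))"
    unfolding mF by (simp add: algebra_simps power2_eq_square)
  then have "[m * d = m\<^sup>2 + 1] (mod int n)"
    by (simp add: cong_iff_dvd_diff N_def)
  ultimately show ?thesis by (rule that)
qed

lemma dedekind_sum_diff_Ints_iff:
  assumes "n > 0" "coprime a (int n)" "coprime b (int n)"
  shows "12 * dedekind_sum a n - 12 * dedekind_sum b n \<in> \<int> \<longleftrightarrow> int n dvd (a - b) * (a * b - 1)"
proof -
  obtain d where d: "of_int d = 12 * real n * dedekind_sum a n" "[a * d = a\<^sup>2 + 1] (mod int n)"
    using dedekind_sum_cong[OF assms(1,2)] .
  obtain e where e: "of_int e = 12 * real n * dedekind_sum b n" "[b * e = b\<^sup>2 + 1] (mod int n)"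
    using dedekind_sum_cong[OF assms(1,3)] .
  have diff: "12 * dedekind_sum a n - 12 * dedekind_sum b n = of_int (d - e) / of_int (int n)"
    using d(1) e(1) assms(1) by (simp add: field_simps)
  have "12 * dedekind_sum a n - 12 * dedekind_sum b n \<in> \<int> \<longleftrightarrow> int n dvd d - e"
    unfolding diff
  proof
    assume "real_of_int (d - e) / of_int (int n) \<in> \<int>"
    then obtain c where "real_of_int (d - e) / of_int (int n) = of_int c" by (elim Ints_cases)
    with assms(1) have "real_of_int (d - e) = of_int (c * int n)" by (simp add: field_simps)
    then have "d - e = c * int n" by linarith
    then show "int n dvd d - e" by simp
  next
    assume "int n dvd d - e"
    then obtain c where "d - e = int n * c" ..
    with assms(1) show "real_of_int (d - e) / of_int (int n) \<in> \<int>" by simp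
  qed
  \<comment> \<open>Multiplying by the unit \<open>a * b\<close> clears the inverses of
    \<open>a\<close> and \<open>b\<close> hidden in \<open>d\<close> and \<open>e\<close>.\<close>
  also have "\<dots> \<longleftrightarrow> int n dvd (a * b) * (d - e)"
    using assms by (simp add: coprime_commute coprime_dvd_mult_right_iff)
  also have "\<dots> \<longleftrightarrow> int n dvd (a - b) * (a * b - 1)"
  proof -
    have "[b * (a * d) - a * (b * e) = b * (a\<^sup>2 + 1) - a * (b\<^sup>2 + 1)] (mod int n)"
      using d(2) e(2) by (intro cong_diff cong_mult cong_refl)
    then have "[(a * b) * (d - e) = (a - b) * (a * b - 1)] (mod int n)"
      by (simp add: algebra_simps power2_eq_square)
    then show ?thesis by (rule cong_dvd_iff)
  qed
  finally show ?thesis .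
qed

section \<open>Counting residues prime by prime\<close>

lemma card_residues_coprime_mult:
  fixes a b :: int
  assumes "a > 0" "b > 0" "coprime a b"
  shows "card {x \<in> {0..<a * b}. P (x mod a) \<and> Q (x mod b)} =
    card {x \<in> {0..<a}. P x} * card {x \<in> {0..<b}. Q x}"
proof -
  let ?S = "{x \<in> {0..<a * b}. P (x mod a) \<and> Q (x mod b)}"
  let ?T = "{x \<in> {0..<a}. P x} \<times> {x \<in> {0..<b}. Q x}"
  have "bij_betw (\<lambda>x. (x mod a, x mod b)) ?S ?T"
  proof (rule bij_betw_imageI)
    show "inj_on (\<lambda>x. (x mod a, x mod b)) ?S"
    proof (rule inj_onI)
      fix x y assume xy: "x \<in> ?S" "y \<in> ?S" "(x mod a, x mod b) = (y mod a, y mod b)"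
      then have "[x = y] (mod a * b)"
        using assms(3) by (intro coprime_cong_mult) (auto simp: cong_def)
      with xy show "x = y" by (simp add: cong_def)
    qed
    show "(\<lambda>x. (x mod a, x mod b)) ` ?S = ?T"
    proof (intro equalityI subsetI)
      fix z assume "z \<in> ?T"
      then obtain u v where z: "z = (u, v)" "0 \<le> u" "u < a" "P u" "0 \<le> v" "v < b" "Q v" by auto
      obtain w where w: "[w = u] (mod a)" "[w = v] (mod b)"
        using binary_chinese_remainder_int[OF assms(3)] by blast
      define x where "x = w mod (a * b)"
      have "x mod a = u" "x mod b = v"
        using w z by (simp_all add: x_def cong_def mod_mod_cancel)
      moreover have "0 \<le> x" "x < a * b" using assms by (simp_all add: x_def)
      ultimately show "z \<in> (\<lambda>x. (x mod a, x mod b)) ` ?S"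
        using z by (intro image_eqI[of _ _ x]) auto
    qed (use assms in auto)
  qed
  then show ?thesis by (simp add: bij_betw_same_card card_cartesian_product)
qed

text \<open>Induction on \<open>I\<close>: each new modulus is coprime to the product of the earlier
  ones, so the two-modulus count applies.\<close>

lemma card_residues_prod:
  fixes q :: "'i \<Rightarrow> int"
  assumes "finite I" "\<And>i. i \<in> I \<Longrightarrow> q i > 0"
    "\<And>i j. i \<in> I \<Longrightarrow> j \<in> I \<Longrightarrow> i \<noteq> j \<Longrightarrow> coprime (q i) (q j)"
  shows "card {x \<in> {0..<(\<Prod>i\<in>I. q i)}. \<forall>i\<in>I. P i (x mod q i)} =
    (\<Prod>i\<in>I. card {x \<in> {0..<q i}. P i x})"
  using assms
proof (induction I rule: finite_induct)
  case empty
  have "{x. 0 \<le> x \<and> x < (1::int)} = {0}" by auto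
  then show ?case by simp
next
  case (insert i I)
  let ?N = "\<Prod>j\<in>I. q j"
  have "coprime (q i) ?N" using insert by (intro prod_coprime_right) auto
  moreover have "?N > 0" using insert by (intro prod_pos) auto
  \<comment> \<open>The conditions indexed by \<open>I\<close> thus depend only on
    \<open>x mod ?N\<close>, as the two-modulus lemma demands.\<close>
  moreover have "x mod ?N mod q j = x mod q j" if "j \<in> I" for x j
    using that insert.hyps by (intro mod_mod_cancel dvd_prodI) auto
  then have "{x \<in> {0..<(\<Prod>j\<in>insert i I. q j)}. \<forall>j\<in>insert i I. P j (x mod q j)} =
      {x \<in> {0..<q i * ?N}. P i (x mod q i) \<and> (\<forall>j\<in>I. P j (x mod ?N mod q j))}"
    using insert.hyps by simp
  ultimately show ?case
    using card_residues_coprime_mult[of "q i" ?N "P i" "\<lambda>y. \<forall>j\<in>I. P j (y mod q j)"] insert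
    by simp
qed

text \<open>A prime dividing the product divides a factor, so the roots are \<open>a\<close> and its
  inverse \<open>b\<close>. They coincide iff \<open>a * a\<close> is 1 modulo \<open>p\<close>,
  that is, iff \<open>p\<close> divides \<open>(a - 1) * (a + 1)\<close>.\<close>

lemma card_roots_mod_prime:
  fixes a p :: int
  assumes "prime p" "coprime a p"
  shows "card {x \<in> {0..<p}. p dvd (a - x) * (a * x - 1)} =
    (if [a = 1] (mod p) \<or> [a = - 1] (mod p) then 1 else 2)"
proof -
  have p: "p > 0" using assms(1) by (simp add: prime_gt_0_int)
  obtain b where b: "[a * b = 1] (mod p)"
    using assms(2) cong_solve_coprime_int by blast
  have iff: "p dvd (a - x) * (a * x - 1) \<longleftrightarrow> x = a mod p \<or> x = b mod p" if x: "x \<in> {0..<p}" for x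
  proof -
    have "p dvd (a - x) * (a * x - 1) \<longleftrightarrow> [a = x] (mod p) \<or> [a * x = 1] (mod p)"
      using assms(1) by (simp add: prime_dvd_mult_iff cong_iff_dvd_diff)
    also have "[a * x = 1] (mod p) \<longleftrightarrow> [a * x = a * b] (mod p)"
      using b cong_trans cong_sym by blast
    also have "\<dots> \<longleftrightarrow> [x = b] (mod p)"
      using assms(2) by (rule cong_mult_lcancel)
    finally show ?thesis using x by (auto simp: cong_def)
  qed
  have roots: "{x \<in> {0..<p}. p dvd (a - x) * (a * x - 1)} = {a mod p, b mod p}"
    using iff p by auto
  have eq: "a mod p = b mod p \<longleftrightarrow> [a = 1] (mod p) \<or> [a = - 1] (mod p)"
  proof -
    have "a mod p = b mod p \<longleftrightarrow> [a * a = a * b] (mod p)"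
      using cong_mult_lcancel[OF assms(2), of a b] by (simp add: cong_def)
    also have "\<dots> \<longleftrightarrow> [a * a = 1] (mod p)"
      using b cong_trans cong_sym by blast
    also have "\<dots> \<longleftrightarrow> p dvd (a - 1) * (a + 1)"
      by (simp add: cong_iff_dvd_diff algebra_simps)
    finally show ?thesis
      using assms(1) by (simp add: prime_dvd_mult_iff cong_iff_dvd_diff)
  qed
  show ?thesis unfolding roots eq[symmetric] by (simp add: card_insert_if)
qed

theorem theorem3:
  fixes t n :: nat and p :: "nat \<Rightarrow> nat" and m1 :: int
  assumes "\<And>j. j \<in> {1..t} \<Longrightarrow> prime (p j)"
    and "inj_on p {1..t}"
    and "n = (\<Prod>j = 1..t. p j)"
    and "gcd m1 (int n) = 1"
  shows "card {m2 :: int. 0 \<le> m2 \<and> m2 < int n \<and> gcd m2 (int n) = 1 \<and>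
                 12 * dedekind_sum m1 n - 12 * dedekind_sum m2 n \<in> \<int>}
         = 2 ^ card {j \<in> {1..t}. \<not> ([m1 = 1] (mod int (p j)) \<or> [m1 = - 1] (mod int (p j)))}"
proof -
  define q where "q j = int (p j)" for j
  let ?R = "\<lambda>j x. q j dvd (m1 - x) * (m1 * x - 1)"
  let ?E = "\<lambda>j. [m1 = 1] (mod int (p j)) \<or> [m1 = - 1] (mod int (p j))"
  have q: "prime (q j)" if "j \<in> {1..t}" for j
    using assms(1)[OF that] by (simp add: q_def)
  have n: "int n = (\<Prod>j = 1..t. q j)" by (simp add: assms(3) q_def)
  have "n > 0" unfolding assms(3) using assms(1) by (intro prod_pos) (auto simp: prime_gt_0_nat)
  have q_dvd_n: "q j dvd int n" if "j \<in> {1..t}" for j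
    unfolding n using that by (intro dvd_prodI) auto
  have m1: "coprime m1 (int n)" using assms(4) by (simp add: coprime_iff_gcd_eq_1)
  then have m1_q: "coprime m1 (q j)" if "j \<in> {1..t}" for j
    using q_dvd_n[OF that] by (meson coprime_divisors dvd_refl)
  have coprime_q: "coprime (q i) (q j)" if "i \<in> {1..t}" "j \<in> {1..t}" "i \<noteq> j" for i j
  proof -
    have "p i \<noteq> p j" using assms(2) that by (auto dest: inj_onD)
    then show ?thesis using that assms(1) by (simp add: q_def primes_coprime)
  qed
  have n_dvd: "int n dvd y \<longleftrightarrow> (\<forall>j\<in>{1..t}. q j dvd y)" for y
    using cong_cong_prod_coprime[of "{1..t}" y 0 q] coprime_q q_dvd_n dvd_trans
    unfolding n cong_0_iff by blast
  \<comment> \<open>Brings the local conditions into the form of predicates on residues that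
    \<open>card_residues_prod\<close> counts.\<close>
  have mod_R: "?R j (x mod q j) \<longleftrightarrow> ?R j x" for j x
    by (intro cong_dvd_iff cong_mult cong_diff cong_refl) (simp_all add: cong_def)
  \<comment> \<open>Modulo each \<open>q j\<close>, a root is \<open>m1\<close> or its inverse, a
    unit either way. The divisibility therefore absorbs the coprimality condition on
    \<open>m2\<close>.\<close>
  have root_coprime: "coprime x (int n)" if "int n dvd (m1 - x) * (m1 * x - 1)" for x
    unfolding n
  proof (rule prod_coprime_right)
    fix j assume j: "j \<in> {1..t}"
    with that have "q j dvd (m1 - x) * (m1 * x - 1)" by (simp add: n_dvd)
    then have "[m1 = x] (mod q j) \<or> [1 = m1 * x] (mod q j)"
      using q[OF j] by (simp add: prime_dvd_mult_iff cong_iff_dvd_diff dvd_diff_commute)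
    then show "coprime x (q j)"
    proof
      assume "[m1 = x] (mod q j)"
      then show ?thesis using m1_q[OF j] by (rule cong_imp_coprime)
    next
      assume "[1 = m1 * x] (mod q j)"
      then have "coprime (m1 * x) (q j)" by (rule cong_imp_coprime) simp
      then show ?thesis by simp
    qed
  qed
  have solutions: "{m2 :: int. 0 \<le> m2 \<and> m2 < int n \<and> gcd m2 (int n) = 1 \<and>
      12 * dedekind_sum m1 n - 12 * dedekind_sum m2 n \<in> \<int>} =
    {x \<in> {0..<(\<Prod>j = 1..t. q j)}. \<forall>j\<in>{1..t}. ?R j (x mod q j)}"
    using dedekind_sum_diff_Ints_iff[OF \<open>n > 0\<close> m1] root_coprime
    unfolding mod_R n_dvd[symmetric] n[symmetric] coprime_iff_gcd_eq_1[symmetric] by auto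
  have "card {x \<in> {0..<(\<Prod>j = 1..t. q j)}. \<forall>j\<in>{1..t}. ?R j (x mod q j)} =
    (\<Prod>j = 1..t. card {x \<in> {0..<q j}. ?R j x})"
    using q coprime_q by (intro card_residues_prod) (auto simp: prime_gt_0_int)
  also have "\<dots> = (\<Prod>j = 1..t. if ?E j then 1 else 2)"
    unfolding q_def[symmetric] by (intro prod.cong refl card_roots_mod_prime q m1_q)
  \<comment> \<open>With the neutral factor 1 in the else branch, the product restricts to the
    indices contributing a factor 2.\<close>
  also have "\<dots> = (\<Prod>j = 1..t. if \<not> ?E j then 2 else 1)"
    by (rule prod.cong[OF refl]) presburger
  also have "\<dots> = (\<Prod>j \<in> {j \<in> {1..t}. \<not> ?E j}. 2)"
    by (rule prod.inter_filter[symmetric]) (rule finite_atLeastAtMost)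
  also have "\<dots> = 2 ^ card {j \<in> {1..t}. \<not> ?E j}"
    by (rule prod_constant)
  finally show ?thesis unfolding solutions .
qed

end
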